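(* Let $\mu\in[\mu_{\min},\infty)$, where $\mu_{\min}=2+\omega+\omega^{-1}\approx 4.38$ with $\omega=\frac13\left(\sqrt[3]{19+3\sqrt{33}}+\sqrt[3]{19-3\sqrt{33}}+1\right)$. Let $(G_k(\mu))_{k\ge 2}$ be the classic Laplacian Shearer sequence of caterpillars associated with $\mu$. Then this sequence produces a limit point of Laplacian spectral radii: the limit $$\lim_{k\to\infty}\rho_L(G_k(\mu))=\gamma(\mu)$$ exists and $\gamma(\mu)\le\mu$.
   Context: For a finite graph $G$, $\rho_L(G)$ is the largest eigenvalue of the Laplacian matrix $L(G)=D(G)-A(G)$. A real number $\gamma$ is a limit point of Laplacian spectral radii if there is a sequence of graphs $H_1,H_2,\dots$ with pairwise distinct values $\rho_L(H_i)$ and $\lim_i\rho_L(H_i)=\gamma$. The caterpillar $[r_1,\dots,r_k]$ ($r_i\ge 0$ integers) is the tree obtained from a path $v_1v_2\cdots v_k$ by attaching $r_i$ pendant vertices (leaves) at $v_i$ for each $i$. Classic Laplacian Shearer sequence: given $\mu$, put $\theta'=\frac{-(\mu-2)+\sqrt{(\mu-2)^2-4}}{2}$ and $\psi(t)=2-\mu-\frac1t$ for $t\ne0$. For each $k\ge2$, $G_k(\mu)=[r_1,\dots,r_k]$ where $r_1=\left\lfloor\frac{\mu-1}{\mu}(\theta'-(1-\mu))\right\rfloor$, $S_1=1-\mu+r_1\frac{\mu}{\mu-1}$; for $2\le j\le k-1$: $r_j=\left\lfloor\frac{\mu-1}{\mu}(\theta'-\psi(S_{j-1}))\right\rfloor$,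 $S_j=\psi(S_{j-1})+r_j\frac{\mu}{\mu-1}$; and $r_k=\left\lfloor\frac{\mu-1}{\mu}(\theta'+1-\psi(S_{k-1}))\right\rfloor$ (the last entry uses a different formula, so the last entry of $G_k(\mu)$ need not equal the $k$-th entry of $G_{k+1}(\mu)$). *)

theory Defs
  imports Complex_Main "Jordan_Normal_Form.Char_Poly" "Graph_Theory.Pair_Digraph"
begin

text \<open>
  Finite simple graphs are rendered by the locale \<open>pair_graph\<close>: finite digraphs without loops and
  without parallel arcs whose arc relation is symmetric, an edge being a pair of opposite arcs.
  In particular \<open>out_degree\<close> is the degree.
\<close>

text \<open>
  Some enumeration of the vertices, used to index matrix rows and columns. Another choice changes
  the matrices below by a simultaneous permutation of rows and columns only.
\<close>

definition vertex_list :: "'a pair_pre_digraph \<Rightarrow> 'a list" where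
  "vertex_list G = (SOME vs. distinct vs \<and> set vs = pverts G)"

definition adjacency_mat :: "'a pair_pre_digraph \<Rightarrow> real mat" where
  "adjacency_mat G =
     (let vs = vertex_list G; n = card (pverts G)
      in mat n n (\<lambda>(i, j). if (vs ! i, vs ! j) \<in> parcs G then 1 else 0))"

definition degree_mat :: "'a pair_pre_digraph \<Rightarrow> real mat" where
  "degree_mat G =
     (let vs = vertex_list G; n = card (pverts G)
      in mat n n (\<lambda>(i, j). if i = j then real (out_degree (with_proj G) (vs ! i)) else 0))"

definition laplacian_mat :: "'a pair_pre_digraph \<Rightarrow> real mat" where
  "laplacian_mat G = degree_mat G - adjacency_mat G"

text \<open>The Laplacian is real symmetric, so all its complex eigenvalues are real.\<close>

definition laplacian_radius :: "'a pair_pre_digraph \<Rightarrow> real" where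
  "laplacian_radius G = Max {x. eigenvalue (laplacian_mat G) x}"

text \<open>Every finite graph is isomorphic to one whose vertices are natural numbers.\<close>

definition laplacian_limit_point :: "real \<Rightarrow> bool" where
  "laplacian_limit_point \<gamma> \<longleftrightarrow>
     (\<exists>H :: nat \<Rightarrow> nat pair_pre_digraph.
        (\<forall>i. pair_graph (H i) \<and> pverts (H i) \<noteq> {}) \<and>
        inj (\<lambda>i. laplacian_radius (H i)) \<and>
        (\<lambda>i. laplacian_radius (H i)) \<longlonglongrightarrow> \<gamma>)"

text \<open>
  The caterpillar \<open>[r\<^sub>1, \<dots>, r\<^sub>k]\<close>: the spine vertices are \<open>(i, 0)\<close> for \<open>i < k\<close>, and the leaves
  attached to \<open>(i, 0)\<close> are \<open>(i, j)\<close> for \<open>1 \<le> j \<le> rs ! i\<close>. List positions start at 0, so \<open>(i, 0)\<close>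
  is the vertex \<open>v\<^sub>i\<^sub>+\<^sub>1\<close>.
\<close>

definition caterpillar_edges :: "nat list \<Rightarrow> (nat \<times> nat) rel" where
  "caterpillar_edges rs =
     {((i, 0), (Suc i, 0)) | i. Suc i < length rs} \<union>
     {((i, 0), (i, j)) | i j. i < length rs \<and> 1 \<le> j \<and> j \<le> rs ! i}"

definition caterpillar :: "nat list \<Rightarrow> (nat \<times> nat) pair_pre_digraph" where
  "caterpillar rs =
     \<lparr> pverts = {(i, j). i < length rs \<and> j \<le> rs ! i},
       parcs = caterpillar_edges rs \<union> (caterpillar_edges rs)\<inverse> \<rparr>"

lemma pair_graph_caterpillar: "pair_graph (caterpillar rs)"
proof -
  have "pverts (caterpillar rs) = (SIGMA i:{..<length rs}. {..rs ! i})"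
    by (auto simp: caterpillar_def)
  then have fin: "finite (pverts (caterpillar rs))"
    by simp
  have sub: "parcs (caterpillar rs) \<subseteq> pverts (caterpillar rs) \<times> pverts (caterpillar rs)"
    by (auto simp: caterpillar_def caterpillar_edges_def)
  show ?thesis
  proof
    show "finite (parcs (caterpillar rs))"
      using sub fin by (meson finite_SigmaI finite_subset)
    show "symmetric (with_proj (caterpillar rs))"
      by (auto simp: symmetric_def caterpillar_def sym_Un_converse)
  qed (use sub fin in \<open>auto simp: caterpillar_def caterpillar_edges_def\<close>)
qed

definition shearer_theta :: "real \<Rightarrow> real" where
  "shearer_theta \<mu> = (- (\<mu> - 2) + sqrt ((\<mu> - 2)\<^sup>2 - 4)) / 2"

definition shearer_psi :: "real \<Rightarrow> real \<Rightarrow> real" where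
  "shearer_psi \<mu> t = 2 - \<mu> - 1 / t"

text \<open>
  Indices are shifted by one: \<open>shearer_r \<mu> j\<close> and \<open>shearer_S \<mu> j\<close> are \<open>r\<^sub>j\<^sub>+\<^sub>1\<close> and \<open>S\<^sub>j\<^sub>+\<^sub>1\<close>.
  For \<open>\<mu> > 4\<close> one has \<open>S\<^sub>j \<le> \<theta>' < 0\<close> and \<open>\<psi>(\<theta>') = \<theta>'\<close>, hence \<open>\<psi>(S\<^sub>j) \<le> \<theta>'\<close>; so neither the
  truncation of negative integers by \<open>nat\<close> nor the division by zero in \<open>shearer_psi\<close> ever occurs.
\<close>

fun shearer_r :: "real \<Rightarrow> nat \<Rightarrow> nat" and shearer_S :: "real \<Rightarrow> nat \<Rightarrow> real" where
  "shearer_r \<mu> 0 = nat \<lfloor>(\<mu> - 1) / \<mu> * (shearer_theta \<mu> - (1 - \<mu>))\<rfloor>"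
| "shearer_S \<mu> 0 = 1 - \<mu> + real (shearer_r \<mu> 0) * (\<mu> / (\<mu> - 1))"
| "shearer_r \<mu> (Suc j) =
     nat \<lfloor>(\<mu> - 1) / \<mu> * (shearer_theta \<mu> - shearer_psi \<mu> (shearer_S \<mu> j))\<rfloor>"
| "shearer_S \<mu> (Suc j) =
     shearer_psi \<mu> (shearer_S \<mu> j) + real (shearer_r \<mu> (Suc j)) * (\<mu> / (\<mu> - 1))"

definition shearer_last :: "real \<Rightarrow> nat \<Rightarrow> nat" where
  "shearer_last \<mu> k =
     nat \<lfloor>(\<mu> - 1) / \<mu> * (shearer_theta \<mu> + 1 - shearer_psi \<mu> (shearer_S \<mu> (k - 2)))\<rfloor>"

text \<open>\<open>G\<^sub>k(\<mu>)\<close>, meaningful for \<open>k \<ge> 2\<close> only; \<open>shearer_S \<mu> (k - 2)\<close> above is \<open>S\<^sub>k\<^sub>-\<^sub>1\<close>.\<close>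

definition shearer_graph :: "real \<Rightarrow> nat \<Rightarrow> (nat \<times> nat) pair_pre_digraph" where
  "shearer_graph \<mu> k = caterpillar (map (shearer_r \<mu>) [0..<k - 1] @ [shearer_last \<mu> k])"

definition shearer_omega :: real where
  "shearer_omega = 1 / 3 * (root 3 (19 + 3 * sqrt 33) + root 3 (19 - 3 * sqrt 33) + 1)"

definition mu_min :: real where
  "mu_min = 2 + shearer_omega + inverse shearer_omega"

end

theory Submission
  imports Defs "HOL-Analysis.Function_Topology" "HOL-Library.Nat_Bijection"
begin

text \<open>
  Put \<open>z\<^sub>1 = 1\<close> and \<open>z\<^sub>j\<^sub>+\<^sub>1 = - S\<^sub>j z\<^sub>j\<close> on the spine and \<open>z\<^sub>j / (\<mu> - 1)\<close> on the leaves at \<open>v\<^sub>j\<close>. Since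
  \<open>S\<^sub>j \<le> \<theta>' < 0\<close>, this vector is positive, and the choice of \<open>r\<^sub>k\<close> makes it satisfy \<open>Q z \<le> \<mu> z\<close> for the
  signless Laplacian \<open>Q\<close> of \<open>G\<^sub>k\<close>; hence \<open>\<rho>\<^sub>L(G\<^sub>k) \<le> \<mu>\<close>. The last entry of \<open>G\<^sub>k\<close> exceeds the \<open>k\<close>-th
  entry of \<open>G\<^sub>k\<^sub>+\<^sub>1\<close> by at most one, and \<open>v\<^sub>k\<^sub>+\<^sub>1\<close> can take the place of the surplus leaf, so \<open>G\<^sub>k\<close> embeds
  into \<open>G\<^sub>k\<^sub>+\<^sub>1\<close> and the radii increase. The two graphs may be isomorphic, but \<open>G\<^sub>k\<^sub>+\<^sub>2\<close> always has more
  vertices than \<open>G\<^sub>k\<close>, so by Perron--Frobenius the radius is strictly increasing along every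
  second index.
\<close>

section \<open>The Laplacian radius as a maximal Rayleigh quotient\<close>

text \<open>The Laplacian acts on functions on the vertex type, so that \<open>vertex_list\<close>
  matters only where matrices are translated.\<close>

definition laplacian_op :: "'a pair_pre_digraph \<Rightarrow> ('a \<Rightarrow> real) \<Rightarrow> 'a \<Rightarrow> real" where
  "laplacian_op G x v = (\<Sum>u\<in>parcs G `` {v}. x v - x u)"

text \<open>The quadratic form of the Laplacian; an edge contributes two opposite arcs, hence the
  factor one half.\<close>

definition edge_form :: "'a pair_pre_digraph \<Rightarrow> ('a \<Rightarrow> real) \<Rightarrow> real" where
  "edge_form G x = (\<Sum>(u, v)\<in>parcs G. (x u - x v)\<^sup>2) / 2"

definition sq_norm_on :: "'a set \<Rightarrow> ('a \<Rightarrow> real) \<Rightarrow> real" where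
  "sq_norm_on V x = (\<Sum>v\<in>V. (x v)\<^sup>2)"

lemma sq_norm_on_cong: "(\<And>v. v \<in> V \<Longrightarrow> x v = y v) \<Longrightarrow> sq_norm_on V x = sq_norm_on V y"
  by (simp add: sq_norm_on_def)

lemma sq_norm_on_add_scaled:
  "sq_norm_on V (\<lambda>v. x v + t * y v) =
     sq_norm_on V x + 2 * t * (\<Sum>v\<in>V. y v * x v) + t\<^sup>2 * sq_norm_on V y"
  by (simp add: sq_norm_on_def power2_sum power_mult_distrib sum.distrib sum_distrib_left
      algebra_simps)

text \<open>Near zero the linear term dominates, so it must vanish. This serves as the first-order
  condition at a maximizer.\<close>

lemma linear_coeff_eq_0:
  fixes b c :: real
  assumes "\<And>t. 0 \<le> t * b + t\<^sup>2 * c"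
  shows "b = 0"
proof (rule ccontr)
  assume b: "b \<noteq> 0"
  \<comment> \<open>This scale gives \<open>s * c < 1\<close> for either sign of \<open>c\<close>;
    at \<open>t = - s * b\<close> the expression is then negative.\<close>
  define s where "s = 1 / (\<bar>c\<bar> + 1)"
  have s: "s > 0" "s * \<bar>c\<bar> < 1"
    by (auto simp: s_def field_simps)
  have "s * c \<le> s * \<bar>c\<bar>"
    using s by (intro mult_left_mono) auto
  then have "s * c < 1"
    using s by linarith
  have "0 \<le> - s * b * b + (- s * b)\<^sup>2 * c"
    using assms[of "- s * b"] .
  also have "\<dots> = - (s * b\<^sup>2) * (1 - s * c)"
    by (simp add: algebra_simps power2_eq_square)
  also have "\<dots> < 0"
    using s b \<open>s * c < 1\<close> by (simp add: mult_pos_pos mult_neg_pos)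
  finally show False
    by simp
qed

context pair_graph
begin

lemma finite_nbhd: "finite (parcs G `` {v})"
  by (rule finite_subset[OF _ pair_finite_verts]) (auto dest: in_arcsD2)

lemma sum_parcs: "(\<Sum>(u, v)\<in>parcs G. g u v) = (\<Sum>u\<in>pverts G. \<Sum>v\<in>parcs G `` {u}. g u v)"
proof -
  have "parcs G = Sigma (pverts G) (\<lambda>u. parcs G `` {u})"
    by (auto dest: in_arcsD1)
  then show ?thesis
    by (subst sum.Sigma) (auto simp: pair_finite_verts finite_nbhd)
qed

lemma sum_parcs_swap: "(\<Sum>(u, v)\<in>parcs G. g u v) = (\<Sum>(u, v)\<in>parcs G. g v u)"
  by (rule sum.reindex_bij_witness[of _ prod.swap prod.swap]) (auto intro: arcs_symmetric)

text \<open>Summation by parts: expanding the second factor gives two arc sums, which reversing all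
  arcs identifies.\<close>

lemma edge_form_bilinear:
  "(\<Sum>(u, v)\<in>parcs G. (x u - x v) * (y u - y v)) = 2 * (\<Sum>v\<in>pverts G. y v * laplacian_op G x v)"
proof -
  have "(\<Sum>(u, v)\<in>parcs G. (x u - x v) * (y u - y v)) =
      (\<Sum>(u, v)\<in>parcs G. y u * (x u - x v)) + (\<Sum>(u, v)\<in>parcs G. y v * (x v - x u))"
    by (simp add: sum.distrib[symmetric] case_prod_unfold algebra_simps)
  also have "\<dots> = 2 * (\<Sum>(u, v)\<in>parcs G. y u * (x u - x v))"
    by (subst (2) sum_parcs_swap) simp
  finally show ?thesis
    by (simp add: sum_parcs laplacian_op_def sum_distrib_left)
qed

lemma edge_form_add_scaled:
  "edge_form G (\<lambda>v. x v + t * y v) =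
     edge_form G x + 2 * t * (\<Sum>v\<in>pverts G. y v * laplacian_op G x v) + t\<^sup>2 * edge_form G y"
proof -
  have "2 * edge_form G (\<lambda>v. x v + t * y v) =
      (\<Sum>(u, v)\<in>parcs G. (x u - x v)\<^sup>2) + 2 * t * (\<Sum>(u, v)\<in>parcs G. (x u - x v) * (y u - y v))
      + t\<^sup>2 * (\<Sum>(u, v)\<in>parcs G. (y u - y v)\<^sup>2)"
    unfolding edge_form_def
    by (simp add: sum_distrib_left sum.distrib[symmetric] case_prod_unfold power2_eq_square
        algebra_simps)
  then show ?thesis
    unfolding edge_form_bilinear by (simp add: edge_form_def)
qed

lemma edge_form_eq: "edge_form G x = (\<Sum>v\<in>pverts G. x v * laplacian_op G x v)"
  using edge_form_bilinear[of x x] by (simp add: edge_form_def power2_eq_square)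

lemma edge_form_cong:
  assumes "\<And>v. v \<in> pverts G \<Longrightarrow> x v = y v"
  shows "edge_form G x = edge_form G y"
proof -
  have "(\<Sum>(u, v)\<in>parcs G. (x u - x v)\<^sup>2) = (\<Sum>(u, v)\<in>parcs G. (y u - y v)\<^sup>2)"
    using assms arc_fst_in_verts arc_snd_in_verts by (intro sum.cong) (auto simp: case_prod_unfold)
  then show ?thesis
    by (simp add: edge_form_def)
qed

text \<open>\<open>R * sq_norm_on (pverts G) y - edge_form G y\<close> is nonnegative and vanishes
  at \<open>x\<close>, so its derivative in each coordinate direction is zero there; in direction
  \<open>v\<close> this is the eigenvalue equation.\<close>

lemma maximizer_imp_laplacian_op:
  assumes le: "\<And>y. edge_form G y \<le> R * sq_norm_on (pverts G) y"
    and eq: "edge_form G x = R * sq_norm_on (pverts G) x" and v: "v \<in> pverts G"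
  shows "laplacian_op G x v = R * x v"
proof -
  let ?e = "\<lambda>u. if u = v then 1 else (0::real)"
  have *: "(\<Sum>u\<in>pverts G. ?e u * f u) = f v" for f :: "'a \<Rightarrow> real"
    using v pair_finite_verts by (simp add: if_distrib[of "\<lambda>a. a * _"] cong: if_cong)
  have "0 \<le> t * (2 * (R * x v - laplacian_op G x v))
      + t\<^sup>2 * (R * sq_norm_on (pverts G) ?e - edge_form G ?e)" for t
    using le[of "\<lambda>u. x u + t * ?e u"] unfolding edge_form_add_scaled sq_norm_on_add_scaled eq *
    by (simp add: algebra_simps)
  from linear_coeff_eq_0[OF this] show ?thesis
    by simp
qed

lemma rayleigh_maximizer_exists:
  assumes "pverts G \<noteq> {}"
  obtains x where "sq_norm_on (pverts G) x = 1"
    "\<And>y. edge_form G y \<le> edge_form G x * sq_norm_on (pverts G) y"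
proof -
  let ?V = "pverts G"
  \<comment> \<open>The norm ignores coordinates outside the graph. Pinning these to 0 and confining
    the others to \<open>{-1..1}\<close> puts the unit sphere into a product of compact sets,
    compact even for an infinite vertex type.\<close>
  define K :: "('a \<Rightarrow> real) set" where
    "K = (\<Pi>\<^sub>E v\<in>UNIV. if v \<in> ?V then {-1..1} else {0}) \<inter> {x. sq_norm_on ?V x = 1}"
  have "compactin (product_topology (\<lambda>_. euclidean) UNIV)
      (\<Pi>\<^sub>E v\<in>UNIV. if v \<in> ?V then {-1..1} else {0::real})"
    by (subst compactin_PiE) auto
  then have "compact (\<Pi>\<^sub>E v\<in>UNIV. if v \<in> ?V then {-1..1} else {0::real})"
    by (simp add: euclidean_product_topology)
  moreover have "continuous_on UNIV (\<lambda>x::'a \<Rightarrow> real. sq_norm_on ?V x)"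
    unfolding sq_norm_on_def by (intro continuous_intros continuous_on_product_coordinates)
  then have "closed {x::'a \<Rightarrow> real. sq_norm_on ?V x = 1}"
    by (intro closed_Collect_eq continuous_intros)
  ultimately have "compact K"
    unfolding K_def by (rule compact_Int_closed)
  obtain w where w: "w \<in> ?V"
    using assms by blast
  have "sq_norm_on ?V (\<lambda>v. if v = w then 1 else 0) = 1"
    using w pair_finite_verts by (simp add: sq_norm_on_def if_distrib[of "\<lambda>a. a\<^sup>2"] cong: if_cong)
  then have "(\<lambda>v. if v = w then 1 else 0) \<in> K"
    using w by (auto simp: K_def)
  then have "K \<noteq> {}"
    by blast
  have "continuous_on K (edge_form G)"
    unfolding edge_form_def case_prod_unfold
    by (intro continuous_intros continuous_on_subset[OF continuous_on_product_coordinates]) auto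
  from continuous_attains_sup[OF \<open>compact K\<close> \<open>K \<noteq> {}\<close> this]
  obtain x where x: "x \<in> K" and max: "\<And>y. y \<in> K \<Longrightarrow> edge_form G y \<le> edge_form G x"
    by blast
  have "edge_form G y \<le> edge_form G x * sq_norm_on ?V y" for y
  proof (cases "sq_norm_on ?V y = 0")
    case True
    then have "y v = 0" if "v \<in> ?V" for v
      using that pair_finite_verts by (simp add: sq_norm_on_def sum_nonneg_eq_0_iff)
    then have "edge_form G y = edge_form G (\<lambda>_. 0)"
      by (intro edge_form_cong) auto
    with True show ?thesis
      by (simp add: edge_form_def)
  next
    case False
    define n where "n = sqrt (sq_norm_on ?V y)"
    have "sq_norm_on ?V y \<ge> 0"
      by (simp add: sq_norm_on_def sum_nonneg)
    with False have n: "n > 0" "n\<^sup>2 = sq_norm_on ?V y"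
      by (auto simp: n_def)
    \<comment> \<open>Rescaling alone may leave \<open>K\<close>, so values outside the graph are
      reset to 0; both forms ignore them.\<close>
    define z where "z v = (if v \<in> ?V then y v / n else 0)" for v
    have "- n \<le> y v \<and> y v \<le> n" if "v \<in> ?V" for v
    proof -
      have "(y v)\<^sup>2 \<le> n\<^sup>2"
        unfolding n sq_norm_on_def using that pair_finite_verts by (intro member_le_sum) auto
      then show ?thesis
        using n(1) by (metis abs_le_iff abs_le_square_iff abs_of_pos minus_le_iff)
    qed
    then have "z v \<in> (if v \<in> ?V then {-1..1} else {0})" for v
      using n(1) by (auto simp: z_def field_simps)
    moreover have z_norm: "sq_norm_on ?V z = 1"
    proof -
      have "sq_norm_on ?V z = sq_norm_on ?V (\<lambda>v. y v / n)"
        by (intro sq_norm_on_cong) (simp add: z_def)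
      also have "\<dots> = sq_norm_on ?V y / n\<^sup>2"
        by (simp add: sq_norm_on_def power_divide sum_divide_distrib)
      finally show ?thesis
        using n False by simp
    qed
    ultimately have "edge_form G z \<le> edge_form G x"
      by (intro max) (simp add: K_def PiE_iff)
    moreover have "edge_form G z = edge_form G (\<lambda>v. y v / n)"
      by (intro edge_form_cong) (simp add: z_def)
    moreover have "\<dots> = edge_form G y / n\<^sup>2"
      by (simp add: edge_form_def diff_divide_distrib[symmetric] power_divide sum_divide_distrib
          case_prod_unfold mult.commute)
    ultimately show ?thesis
      using n zero_less_power[OF n(1), of 2] by (simp add: pos_divide_le_eq)
  qed
  moreover have "sq_norm_on ?V x = 1"
    using x by (simp add: K_def)
  ultimately show ?thesis
    by (rule that[rotated])
qed

section \<open>Eigenvalues of the Laplacian matrix in terms of functions on vertices\<close>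

lemma vertex_list_bij: "bij_betw (\<lambda>i. vertex_list G ! i) {..<card (pverts G)} (pverts G)"
proof -
  have "\<exists>vs. distinct vs \<and> set vs = pverts G"
    using finite_distinct_list[OF pair_finite_verts] by blast
  from someI_ex[OF this] have *: "distinct (vertex_list G)" "set (vertex_list G) = pverts G"
    by (simp_all add: vertex_list_def)
  then have "length (vertex_list G) = card (pverts G)"
    using distinct_card by fastforce
  then show ?thesis
    using * by (metis bij_betw_nth)
qed

lemma out_degree_eq_card_nbhd: "out_degree (with_proj G) v = card (parcs G `` {v})"
proof -
  have "out_arcs (with_proj G) v = Pair v ` (parcs G `` {v})"
    by (auto simp: Digraph.out_arcs_def)
  then show ?thesis
    by (simp add: Digraph.out_degree_def card_image inj_on_def)
qed

lemma laplacian_mat_mult_vec: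
  assumes i: "i < card (pverts G)"
  shows "(laplacian_mat G *\<^sub>v vec (card (pverts G)) (\<lambda>i. x (vertex_list G ! i))) $ i =
     laplacian_op G x (vertex_list G ! i)"
proof -
  let ?n = "card (pverts G)" and ?w = "\<lambda>i. vertex_list G ! i"
  have "(laplacian_mat G *\<^sub>v vec ?n (\<lambda>i. x (?w i))) $ i =
      (\<Sum>j<?n. ((if ?w i = ?w j then real (out_degree (with_proj G) (?w i)) else 0)
          - (if (?w i, ?w j) \<in> parcs G then 1 else 0)) * x (?w j))"
    using i bij_betw_imp_inj_on[OF vertex_list_bij]
    by (auto simp: laplacian_mat_def degree_mat_def adjacency_mat_def Let_def scalar_prod_def
        lessThan_atLeast0 inj_on_eq_iff intro!: sum.cong)
  also have "\<dots> = (\<Sum>u\<in>pverts G. ((if ?w i = u then real (out_degree (with_proj G) (?w i)) else 0)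
          - (if (?w i, u) \<in> parcs G then 1 else 0)) * x u)"
    by (rule sum.reindex_bij_betw[OF vertex_list_bij])
  also have "\<dots> = (\<Sum>u\<in>pverts G. if ?w i = u then real (out_degree (with_proj G) (?w i)) * x u else 0)
      - (\<Sum>u\<in>pverts G. if (?w i, u) \<in> parcs G then x u else 0)"
    unfolding sum_subtractf[symmetric] by (intro sum.cong) (auto simp: algebra_simps)
  also have "(\<Sum>u\<in>pverts G. if ?w i = u then real (out_degree (with_proj G) (?w i)) * x u else 0)
      = real (out_degree (with_proj G) (?w i)) * x (?w i)"
    using bij_betwE[OF vertex_list_bij] i pair_finite_verts by simp
  also have "(\<Sum>u\<in>pverts G. if (?w i, u) \<in> parcs G then x u else 0) = (\<Sum>u\<in>parcs G `` {?w i}. x u)"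
    by (intro sum.mono_neutral_cong_right) (auto simp: pair_finite_verts dest: in_arcsD2)
  finally show ?thesis
    by (simp add: laplacian_op_def sum_subtractf out_degree_eq_card_nbhd)
qed

lemma laplacian_mat_carrier: "laplacian_mat G \<in> carrier_mat (card (pverts G)) (card (pverts G))"
  by (auto simp: laplacian_mat_def degree_mat_def adjacency_mat_def Let_def)

lemma eigenvalue_laplacian_mat_iff:
  "eigenvalue (laplacian_mat G) l \<longleftrightarrow>
     (\<exists>x. (\<exists>v\<in>pverts G. x v \<noteq> 0) \<and> (\<forall>v\<in>pverts G. laplacian_op G x v = l * x v))"
  (is "_ \<longleftrightarrow> (\<exists>x. ?nz x \<and> ?eq x)")
proof -
  let ?n = "card (pverts G)" and ?w = "\<lambda>i. vertex_list G ! i"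
  let ?vec = "\<lambda>x. vec ?n (\<lambda>i. x (?w i))"
  have dim: "dim_row (laplacian_mat G) = ?n"
    using laplacian_mat_carrier by auto
  have V: "pverts G = ?w ` {..<?n}"
    using bij_betw_imp_surj_on[OF vertex_list_bij] by simp
  have *: "eigenvector (laplacian_mat G) (?vec x) l \<longleftrightarrow> ?nz x \<and> ?eq x" for x
  proof -
    have "?vec x \<noteq> 0\<^sub>v ?n \<longleftrightarrow> ?nz x"
      by (subst V) (auto simp: vec_eq_iff)
    moreover have "laplacian_mat G *\<^sub>v ?vec x = l \<cdot>\<^sub>v ?vec x \<longleftrightarrow> ?eq x"
      by (subst V) (auto simp: vec_eq_iff dim laplacian_mat_mult_vec simp del: index_mult_mat_vec)
    ultimately show ?thesis
      by (simp add: eigenvector_def dim)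
  qed
  show ?thesis
  proof
    assume "eigenvalue (laplacian_mat G) l"
    then obtain y where y: "eigenvector (laplacian_mat G) y l"
      unfolding eigenvalue_def ..
    then have "y \<in> carrier_vec ?n"
      by (simp add: eigenvector_def dim)
    then have "y = ?vec (\<lambda>v. y $ inv_into {..<?n} ?w v)"
      using bij_betw_inv_into_left[OF vertex_list_bij] by (auto simp: vec_eq_iff)
    then obtain x where "y = ?vec x" ..
    with y show "\<exists>x. ?nz x \<and> ?eq x"
      unfolding *[symmetric] by blast
  next
    assume "\<exists>x. ?nz x \<and> ?eq x"
    with * show "eigenvalue (laplacian_mat G) l"
      unfolding eigenvalue_def by blast
  qed
qed

lemma eigenvalue_laplacian_matE:
  assumes "eigenvalue (laplacian_mat G) l"
  obtains x where "\<exists>v\<in>pverts G. x v \<noteq> 0"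
    "\<forall>v\<in>pverts G. laplacian_op G x v = l * x v"
proof -
  obtain x where "(\<exists>v\<in>pverts G. x v \<noteq> 0) \<and> (\<forall>v\<in>pverts G. laplacian_op G x v = l * x v)"
    using assms unfolding eigenvalue_laplacian_mat_iff ..
  then show ?thesis
    by (intro that[of x]) simp_all
qed

text \<open>Eigenvalues are roots of the monic characteristic polynomial; finiteness gives
  \<open>Max\<close> in \<open>laplacian_radius\<close> its meaning.\<close>

lemma finite_laplacian_eigenvalues: "finite {x. eigenvalue (laplacian_mat G) x}"
proof -
  have "char_poly (laplacian_mat G) \<noteq> 0"
    using degree_monic_char_poly[OF laplacian_mat_carrier] by auto
  then show ?thesis
    unfolding eigenvalue_root_char_poly[OF laplacian_mat_carrier] by (rule poly_roots_finite)
qed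

text \<open>A Rayleigh maximizer satisfies the first-order condition, so its quotient is an
  eigenvalue; every eigenvalue is the quotient of its own eigenfunction and hence no larger.\<close>

lemma laplacian_radius_maximizer:
  assumes "pverts G \<noteq> {}"
  obtains x where "sq_norm_on (pverts G) x = 1" "edge_form G x = laplacian_radius G"
    "\<forall>y. edge_form G y \<le> laplacian_radius G * sq_norm_on (pverts G) y"
    "eigenvalue (laplacian_mat G) (laplacian_radius G)"
proof -
  obtain x where x: "sq_norm_on (pverts G) x = 1"
    and max: "\<And>y. edge_form G y \<le> edge_form G x * sq_norm_on (pverts G) y"
    using rayleigh_maximizer_exists[OF assms] by blast
  have "laplacian_op G x v = edge_form G x * x v" if "v \<in> pverts G" for v
    by (rule maximizer_imp_laplacian_op[OF max _ that]) (simp add: x)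
  moreover have "\<exists>v\<in>pverts G. x v \<noteq> 0"
  proof (rule ccontr)
    assume "\<not> (\<exists>v\<in>pverts G. x v \<noteq> 0)"
    with x show False
      by (simp add: sq_norm_on_def)
  qed
  ultimately have ev: "eigenvalue (laplacian_mat G) (edge_form G x)"
    unfolding eigenvalue_laplacian_mat_iff by blast
  have "l \<le> edge_form G x" if "eigenvalue (laplacian_mat G) l" for l
  proof -
    from that obtain y where y: "\<exists>v\<in>pverts G. y v \<noteq> 0" "\<forall>v\<in>pverts G. laplacian_op G y v = l * y v"
      by (rule eigenvalue_laplacian_matE)
    have "edge_form G y = l * sq_norm_on (pverts G) y"
      by (simp add: edge_form_eq y(2) sq_norm_on_def sum_distrib_left power2_eq_square mult_ac)
    with max[of y] have "l * sq_norm_on (pverts G) y \<le> edge_form G x * sq_norm_on (pverts G) y"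
      by simp
    moreover have "sq_norm_on (pverts G) y > 0"
      unfolding sq_norm_on_def using y(1) pair_finite_verts by (force intro: sum_pos2)
    ultimately show ?thesis
      by simp
  qed
  then have "laplacian_radius G = edge_form G x"
    unfolding laplacian_radius_def using ev finite_laplacian_eigenvalues by (intro Max_eqI) auto
  with x max ev show ?thesis
    by (intro that[of x]) auto
qed

text \<open>Collatz--Wielandt bound for the signless Laplacian, which dominates the Laplacian entrywise.\<close>

lemma laplacian_radius_le_supersolution:
  assumes ne: "pverts G \<noteq> {}"
    and pos: "\<And>v. v \<in> pverts G \<Longrightarrow> 0 < z v"
    and super: "\<And>v. v \<in> pverts G \<Longrightarrow> (\<Sum>u\<in>parcs G `` {v}. z v + z u) \<le> m * z v"
  shows "laplacian_radius G \<le> m"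
proof -
  have "eigenvalue (laplacian_mat G) (laplacian_radius G)"
    by (rule laplacian_radius_maximizer[OF ne])
  then obtain x where nz: "\<exists>v\<in>pverts G. x v \<noteq> 0"
    and eq: "\<forall>v\<in>pverts G. laplacian_op G x v = laplacian_radius G * x v"
    by (rule eigenvalue_laplacian_matE)
  \<comment> \<open>\<open>c\<close> is the least factor with
    \<open>\<bar>x v\<bar> \<le> c * z v\<close> at all vertices; the eigenvalue equation is
    evaluated at a vertex \<open>w\<close> with equality.\<close>
  define c where "c = Max ((\<lambda>v. \<bar>x v\<bar> / z v) ` pverts G)"
  have fin: "finite ((\<lambda>v. \<bar>x v\<bar> / z v) ` pverts G)"
    using pair_finite_verts by simp
  have "c \<in> (\<lambda>v. \<bar>x v\<bar> / z v) ` pverts G"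
    unfolding c_def using fin ne by (intro Max_in) auto
  then obtain w where w: "w \<in> pverts G" "c = \<bar>x w\<bar> / z w"
    by blast
  have le: "\<bar>x v\<bar> \<le> c * z v" if "v \<in> pverts G" for v
  proof -
    have "\<bar>x v\<bar> / z v \<le> c"
      unfolding c_def using fin that by (intro Max_ge) auto
    then show ?thesis
      using pos[OF that] by (simp add: field_simps)
  qed
  have xw: "\<bar>x w\<bar> = c * z w"
    using w pos[OF w(1)] by simp
  obtain v where "v \<in> pverts G" "x v \<noteq> 0"
    using nz by blast
  then have "0 < c * z v"
    using le[of v] by auto
  then have "c > 0"
    using pos[OF \<open>v \<in> pverts G\<close>] by (simp add: zero_less_mult_iff)
  have "laplacian_radius G * \<bar>x w\<bar> \<le> \<bar>laplacian_op G x w\<bar>"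
    by (simp add: bspec[OF eq w(1)] abs_mult mult_right_mono)
  also have "\<dots> \<le> (\<Sum>u\<in>parcs G `` {w}. \<bar>x w\<bar> + \<bar>x u\<bar>)"
    unfolding laplacian_op_def by (intro order_trans[OF sum_abs] sum_mono) simp
  also have "\<dots> \<le> (\<Sum>u\<in>parcs G `` {w}. c * (z w + z u))"
    by (intro sum_mono) (auto simp: distrib_left xw intro: le dest: in_arcsD2)
  also have "\<dots> \<le> c * (m * z w)"
    unfolding sum_distrib_left[symmetric] using \<open>c > 0\<close> super[OF w(1)] by simp
  also have "\<dots> = m * \<bar>x w\<bar>"
    by (simp add: xw)
  finally show ?thesis
    using \<open>c > 0\<close> pos[OF w(1)] by (simp add: xw)
qed

end

section \<open>Monotonicity under embeddings\<close>

text \<open>Distinct arcs of \<open>H\<close> go to distinct arcs of \<open>G\<close>, and the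
  remaining arcs of \<open>G\<close> contribute nonnegative terms.\<close>

lemma edge_form_embedding_le:
  assumes "pair_graph H" "pair_graph G" and inj: "inj_on f (pverts H)"
    and hom: "\<And>u v. (u, v) \<in> parcs H \<Longrightarrow> (f u, f v) \<in> parcs G"
  shows "edge_form H (y \<circ> f) \<le> edge_form G y"
proof -
  interpret H: pair_graph H by fact
  interpret G: pair_graph G by fact
  have "inj_on (map_prod f f) (pverts H \<times> pverts H)"
    using inj inj by (rule map_prod_inj_on)
  then have "inj_on (map_prod f f) (parcs H)"
    by (rule inj_on_subset) (auto dest: H.in_arcsD1 H.in_arcsD2)
  then have "2 * edge_form H (y \<circ> f) = (\<Sum>(u, v)\<in>map_prod f f ` parcs H. (y u - y v)\<^sup>2)"
    by (simp add: edge_form_def sum.reindex case_prod_unfold)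
  also have "\<dots> \<le> (\<Sum>(u, v)\<in>parcs G. (y u - y v)\<^sup>2)"
    using hom by (intro sum_mono2 G.pair_finite_arcs) auto
  finally show ?thesis
    by (simp add: edge_form_def)
qed

text \<open>A maximizer for \<open>H\<close> is carried over by \<open>f\<close> and extended by
  zero. Its vanishing off the image is recorded for the strict comparison.\<close>

lemma laplacian_radius_embedding:
  assumes H: "pair_graph H" and G: "pair_graph G" and ne: "pverts H \<noteq> {}"
    and inj: "inj_on f (pverts H)" and sub: "f ` pverts H \<subseteq> pverts G"
    and hom: "\<And>u v. (u, v) \<in> parcs H \<Longrightarrow> (f u, f v) \<in> parcs G"
  obtains y where "sq_norm_on (pverts G) y = 1" "laplacian_radius H \<le> edge_form G y"
    "\<forall>v. v \<notin> f ` pverts H \<longrightarrow> y v = 0"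
proof -
  interpret H: pair_graph H by fact
  interpret G: pair_graph G by fact
  obtain x where x: "sq_norm_on (pverts H) x = 1" "edge_form H x = laplacian_radius H"
    using ne by (rule H.laplacian_radius_maximizer)
  define y where "y v = (if v \<in> f ` pverts H then x (inv_into (pverts H) f v) else 0)" for v
  have yf: "y (f u) = x u" if "u \<in> pverts H" for u
    using that inj by (simp add: y_def)
  show ?thesis
  proof
    have "sq_norm_on (pverts G) y = sq_norm_on (f ` pverts H) y"
      unfolding sq_norm_on_def using sub
      by (intro sum.mono_neutral_right G.pair_finite_verts) (auto simp: y_def)
    also have "\<dots> = sq_norm_on (pverts H) x"
      using inj yf by (simp add: sq_norm_on_def sum.reindex)
    finally show "sq_norm_on (pverts G) y = 1"
      using x by simp
    have "laplacian_radius H = edge_form H (y \<circ> f)"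
      unfolding x(2)[symmetric] by (rule H.edge_form_cong) (simp add: yf)
    also have "\<dots> \<le> edge_form G y"
      using H G inj hom by (rule edge_form_embedding_le)
    finally show "laplacian_radius H \<le> edge_form G y" .
  qed (simp add: y_def)
qed

lemma laplacian_radius_mono:
  assumes H: "pair_graph H" and G: "pair_graph G" and ne: "pverts H \<noteq> {}"
    and inj: "inj_on f (pverts H)" and sub: "f ` pverts H \<subseteq> pverts G"
    and hom: "\<And>u v. (u, v) \<in> parcs H \<Longrightarrow> (f u, f v) \<in> parcs G"
  shows "laplacian_radius H \<le> laplacian_radius G"
proof -
  interpret G: pair_graph G by fact
  obtain y where y: "sq_norm_on (pverts G) y = 1" "laplacian_radius H \<le> edge_form G y"
    using H G ne inj sub hom by (rule laplacian_radius_embedding)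
  have "pverts G \<noteq> {}"
    using ne sub by blast
  then have "edge_form G y \<le> laplacian_radius G * sq_norm_on (pverts G) y"
    by (rule G.laplacian_radius_maximizer) blast
  with y show ?thesis
    by simp
qed

text \<open>
  Giving a maximizer the signs of a proper 2-colouring keeps it a maximizer, so the absolute values
  form a Perron vector of the signless Laplacian. Such a vector cannot vanish at a vertex outside
  the image of the embedding.
\<close>

lemma laplacian_radius_strict_mono:
  fixes c :: "'b \<Rightarrow> bool"
  assumes H: "pair_graph H" and G: "pair_graph G" and ne: "pverts H \<noteq> {}"
    and inj: "inj_on f (pverts H)" and sub: "f ` pverts H \<subseteq> pverts G"
    and hom: "\<And>u v. (u, v) \<in> parcs H \<Longrightarrow> (f u, f v) \<in> parcs G"
    and colour: "\<And>u v. (u, v) \<in> parcs G \<Longrightarrow> c u \<noteq> c v"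
    and conn: "\<And>u v. u \<in> pverts G \<Longrightarrow> v \<in> pverts G \<Longrightarrow> (u, v) \<in> (parcs G)\<^sup>*"
    and card: "card (pverts H) < card (pverts G)"
  shows "laplacian_radius H < laplacian_radius G"
proof (rule ccontr)
  assume not_less: "\<not> laplacian_radius H < laplacian_radius G"
  interpret G: pair_graph G by fact
  obtain y where y: "sq_norm_on (pverts G) y = 1" "laplacian_radius H \<le> edge_form G y"
    "\<forall>v. v \<notin> f ` pverts H \<longrightarrow> y v = 0"
    using H G ne inj sub hom by (rule laplacian_radius_embedding)
  have "pverts G \<noteq> {}"
    using ne sub by blast
  then have max: "edge_form G z \<le> laplacian_radius G * sq_norm_on (pverts G) z" for z
    by (rule G.laplacian_radius_maximizer) blast
  define w where "w v = (if c v then \<bar>y v\<bar> else - \<bar>y v\<bar>)" for v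
  \<comment> \<open>The ends of an arc have opposite colours, so
    \<open>\<bar>w u - w v\<bar> = \<bar>y u\<bar> + \<bar>y v\<bar>\<close>.\<close>
  have "(y u - y v)\<^sup>2 \<le> (w u - w v)\<^sup>2" if "(u, v) \<in> parcs G" for u v
    using colour[OF that] unfolding abs_le_square_iff[symmetric] by (auto simp: w_def)
  then have "edge_form G y \<le> edge_form G w"
    unfolding edge_form_def by (auto intro!: divide_right_mono sum_mono)
  moreover have norm_w: "sq_norm_on (pverts G) w = 1"
    using y(1) by (simp add: sq_norm_on_def w_def if_distrib[of "\<lambda>a. a\<^sup>2"] cong: if_cong)
  ultimately have "edge_form G w = laplacian_radius G * sq_norm_on (pverts G) w"
    using max[of w] y(2) not_less by simp
  with max have eigen: "laplacian_op G w v = laplacian_radius G * w v" if "v \<in> pverts G" for v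
    using that by (rule G.maximizer_imp_laplacian_op)
  \<comment> \<open>All neighbours of \<open>v\<close> have the other colour, so their values under
    \<open>w\<close> share a sign; where \<open>w v = 0\<close> these values sum to 0 and hence
    vanish one by one.\<close>
  have zero_step: "y u = 0" if "(v, u) \<in> parcs G" "y v = 0" for u v
  proof -
    have "w v = 0"
      using that by (simp add: w_def)
    with eigen[of v] have "(\<Sum>u\<in>parcs G `` {v}. w u) = 0"
      using that G.in_arcsD1 by (auto simp: laplacian_op_def sum_negf)
    moreover have "(\<Sum>u\<in>parcs G `` {v}. w u)
        = (\<Sum>u\<in>parcs G `` {v}. (if c v then - 1 else 1) * \<bar>y u\<bar>)"
      by (intro sum.cong) (auto simp: w_def dest: colour)
    ultimately have "(\<Sum>u\<in>parcs G `` {v}. \<bar>y u\<bar>) = 0"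
      by (simp add: sum_distrib_left[symmetric] split: if_splits)
    then show ?thesis
      using that by (auto simp: sum_nonneg_eq_0_iff G.finite_nbhd)
  qed
  have "\<not> pverts G \<subseteq> f ` pverts H"
  proof
    assume "pverts G \<subseteq> f ` pverts H"
    then have "pverts G = f ` pverts H"
      using sub by blast
    with card inj show False
      by (simp add: card_image)
  qed
  then obtain v0 where v0: "v0 \<in> pverts G" "y v0 = 0"
    using y(3) by blast
  have "y v = 0" if "v \<in> pverts G" for v
    using conn[OF v0(1) that] by induction (auto intro: v0 zero_step)
  then show False
    using y(1) by (simp add: sq_norm_on_def)
qed

section \<open>Transport to natural-number vertices\<close>

definition relabel :: "('a \<Rightarrow> 'b) \<Rightarrow> 'a pair_pre_digraph \<Rightarrow> 'b pair_pre_digraph" where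
  "relabel f G = \<lparr>pverts = f ` pverts G, parcs = map_prod f f ` parcs G\<rparr>"

lemma pair_graph_relabel:
  assumes "pair_graph G" "inj f"
  shows "pair_graph (relabel f G)"
proof -
  interpret pair_graph G by fact
  show ?thesis
  proof
    show "symmetric (with_proj (relabel f G))"
      by (auto simp: symmetric_def relabel_def sym_def intro: arcs_symmetric rev_image_eqI)
  qed (use assms(2) in \<open>auto simp: relabel_def pair_finite_verts pair_finite_arcs in_arcsD1 in_arcsD2
      inj_eq no_loops'\<close>)
qed

text \<open>Both \<open>f\<close> and its inverse on the image are embeddings, so monotonicity
  applies in both directions.\<close>

lemma laplacian_radius_relabel:
  assumes G: "pair_graph G" "pverts G \<noteq> {}" and f: "inj f"
  shows "laplacian_radius (relabel f G) = laplacian_radius G"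
proof (rule antisym)
  show "laplacian_radius (relabel f G) \<le> laplacian_radius G"
    using G f by (intro laplacian_radius_mono[where f = "inv_into UNIV f"] pair_graph_relabel)
      (auto simp: relabel_def inj_on_def)
  show "laplacian_radius G \<le> laplacian_radius (relabel f G)"
    using G f by (intro laplacian_radius_mono[where f = f] pair_graph_relabel)
      (auto simp: relabel_def intro: inj_on_subset)
qed

text \<open>Caterpillars have pairs as vertices while \<open>laplacian_limit_point\<close> asks for
  natural numbers; \<open>prod_encode\<close> mediates.\<close>

lemma laplacian_limit_pointI:
  fixes H :: "nat \<Rightarrow> (nat \<times> nat) pair_pre_digraph"
  assumes H: "\<And>i. pair_graph (H i)" "\<And>i. pverts (H i) \<noteq> {}"
    and "inj (\<lambda>i. laplacian_radius (H i))" "(\<lambda>i. laplacian_radius (H i)) \<longlonglongrightarrow> \<gamma>"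
  shows "laplacian_limit_point \<gamma>"
  unfolding laplacian_limit_point_def
proof (intro exI conjI allI)
  show "pair_graph (relabel prod_encode (H i))" for i
    by (intro pair_graph_relabel H inj_prod_encode)
  show "pverts (relabel prod_encode (H i)) \<noteq> {}" for i
    using H by (simp add: relabel_def)
qed (use assms in \<open>simp_all add: laplacian_radius_relabel inj_prod_encode\<close>)

section \<open>Caterpillars\<close>

lemma pverts_caterpillar: "pverts (caterpillar rs) = (SIGMA i:{..<length rs}. {..rs ! i})"
  by (auto simp: caterpillar_def)

lemma pverts_caterpillar_nonempty: "rs \<noteq> [] \<Longrightarrow> pverts (caterpillar rs) \<noteq> {}"
  by (auto simp: pverts_caterpillar Sigma_empty_iff)

lemma card_pverts_caterpillar: "card (pverts (caterpillar rs)) = length rs + sum_list rs"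
  by (simp add: pverts_caterpillar sum_Suc sum_list_sum_nth lessThan_atLeast0 add.commute)

lemma parcs_caterpillar_iff:
  "((i, j), (i', j')) \<in> parcs (caterpillar rs) \<longleftrightarrow>
     j = 0 \<and> j' = 0 \<and> (i' = Suc i \<and> Suc i < length rs \<or> i = Suc i' \<and> Suc i' < length rs) \<or>
     i' = i \<and> i < length rs \<and> (j = 0 \<and> 1 \<le> j' \<and> j' \<le> rs ! i \<or> j' = 0 \<and> 1 \<le> j \<and> j \<le> rs ! i)"
  by (auto simp: caterpillar_def caterpillar_edges_def)

text \<open>\<open>min 1 (snd u)\<close> is the distance to the spine, so the colour is the parity
  of the distance from \<open>(0, 0)\<close>.\<close>

lemma caterpillar_two_colouring:
  assumes "(u, v) \<in> parcs (caterpillar rs)"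
  shows "even (fst u + min 1 (snd u)) \<noteq> even (fst v + min 1 (snd v))"
  using assms by (cases u; cases v) (auto simp: parcs_caterpillar_iff min_def)

lemma caterpillar_connected:
  assumes "u \<in> pverts (caterpillar rs)" "v \<in> pverts (caterpillar rs)"
  shows "(u, v) \<in> (parcs (caterpillar rs))\<^sup>*"
proof -
  interpret pair_graph "caterpillar rs"
    by (rule pair_graph_caterpillar)
  have sym: "sym ((parcs (caterpillar rs))\<^sup>*)"
    by (intro sym_rtrancl symI) (rule arcs_symmetric)
  have spine: "((0, 0), (i, 0)) \<in> (parcs (caterpillar rs))\<^sup>*" if "i < length rs" for i
    using that
  proof (induction i)
    case (Suc i)
    then have "((0, 0), (i, 0)) \<in> (parcs (caterpillar rs))\<^sup>*"
      by simp
    also have "((i, 0), (Suc i, 0)) \<in> parcs (caterpillar rs)"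
      using Suc.prems by (simp add: parcs_caterpillar_iff)
    finally show ?case .
  qed simp
  have "((0, 0), w) \<in> (parcs (caterpillar rs))\<^sup>*" if "w \<in> pverts (caterpillar rs)" for w
  proof (cases w)
    case (Pair i j)
    then have ij: "i < length rs" "j \<le> rs ! i"
      using that by (auto simp: pverts_caterpillar)
    show ?thesis
    proof (cases "j = 0")
      case True
      with spine ij Pair show ?thesis
        by simp
    next
      case False
      then have "((i, 0), (i, j)) \<in> parcs (caterpillar rs)"
        using ij by (simp add: parcs_caterpillar_iff)
      with spine[OF ij(1)] Pair show ?thesis
        by (auto intro: rtrancl.rtrancl_into_rtrancl)
    qed
  qed
  with assms sym show ?thesis
    by (meson rtrancl_trans symD)
qed

text \<open>If \<open>a = b + 1\<close>, then the last leaf at \<open>(length ps, 0)\<close> becomes the new spine vertex.\<close>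

lemma caterpillar_append_embedding:
  fixes ps :: "nat list"
  assumes "a \<le> Suc b"
  defines "f \<equiv> \<lambda>(i, j). if i = length ps \<and> j = Suc b then (Suc (length ps), 0) else (i, j)"
  shows "inj_on f (pverts (caterpillar (ps @ [a])))"
    and "f ` pverts (caterpillar (ps @ [a])) \<subseteq> pverts (caterpillar (ps @ [b, c]))"
    and "(u, v) \<in> parcs (caterpillar (ps @ [a])) \<Longrightarrow> (f u, f v) \<in> parcs (caterpillar (ps @ [b, c]))"
proof -
  show "inj_on f (pverts (caterpillar (ps @ [a])))"
    by (auto simp: inj_on_def f_def pverts_caterpillar)
  show "f ` pverts (caterpillar (ps @ [a])) \<subseteq> pverts (caterpillar (ps @ [b, c]))"
    using assms by (auto simp: f_def pverts_caterpillar nth_append less_Suc_eq split: if_splits)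
  assume "(u, v) \<in> parcs (caterpillar (ps @ [a]))"
  then show "(f u, f v) \<in> parcs (caterpillar (ps @ [b, c]))"
    using assms by (cases u; cases v)
      (auto simp: f_def parcs_caterpillar_iff nth_append less_Suc_eq split: if_splits)
qed

lemma laplacian_radius_caterpillar_append_mono:
  assumes "a \<le> Suc b"
  shows "laplacian_radius (caterpillar (ps @ [a])) \<le> laplacian_radius (caterpillar (ps @ [b, c]))"
  using caterpillar_append_embedding[OF assms]
  by (intro laplacian_radius_mono pair_graph_caterpillar pverts_caterpillar_nonempty) simp_all

text \<open>The comparison passes through \<open>ps @ [b, c]\<close>. At least one of the two
  embeddings gains a vertex, which makes that step strict.\<close>

lemma laplacian_radius_caterpillar_append2_strict_mono:
  assumes "a \<le> Suc b" "c \<le> Suc d"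
  shows "laplacian_radius (caterpillar (ps @ [a])) < laplacian_radius (caterpillar (ps @ [b, d, e]))"
proof (cases "card (pverts (caterpillar (ps @ [a]))) < card (pverts (caterpillar (ps @ [b, c])))")
  case True
  have "laplacian_radius (caterpillar (ps @ [a])) < laplacian_radius (caterpillar (ps @ [b, c]))"
    using caterpillar_append_embedding[OF assms(1)] True
    by (intro laplacian_radius_strict_mono[where c = "\<lambda>u. even (fst u + min 1 (snd u))"]
        pair_graph_caterpillar pverts_caterpillar_nonempty caterpillar_connected
        caterpillar_two_colouring) simp_all
  also have "\<dots> \<le> laplacian_radius (caterpillar (ps @ [b, d, e]))"
    using laplacian_radius_caterpillar_append_mono[OF assms(2), where ps = "ps @ [b]"] by simp
  finally show ?thesis .
next
  case False
  \<comment> \<open>Without a gain in the first embedding, \<open>a = Suc b\<close> and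
    \<open>c = 0\<close>; the second then gains \<open>d + e + 1\<close> vertices.\<close>
  then have card: "card (pverts (caterpillar ((ps @ [b]) @ [c])))
      < card (pverts (caterpillar ((ps @ [b]) @ [d, e])))"
    using assms by (simp add: card_pverts_caterpillar)
  have "laplacian_radius (caterpillar (ps @ [a])) \<le> laplacian_radius (caterpillar ((ps @ [b]) @ [c]))"
    using laplacian_radius_caterpillar_append_mono[OF assms(1)] by simp
  also have "\<dots> < laplacian_radius (caterpillar ((ps @ [b]) @ [d, e]))"
    using caterpillar_append_embedding[OF assms(2), where ps = "ps @ [b]"] card
    by (intro laplacian_radius_strict_mono[where c = "\<lambda>u. even (fst u + min 1 (snd u))"]
        pair_graph_caterpillar pverts_caterpillar_nonempty caterpillar_connected
        caterpillar_two_colouring) simp_all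
  finally show ?thesis
    by simp
qed

text \<open>Extending the spine weights by \<open>z i / (m - 1)\<close> to the leaves gives equality
  at every leaf and makes each leaf contribute \<open>m / (m - 1) * z i\<close> at its spine vertex.
  Only the spine inequalities \<open>super\<close> remain.\<close>

lemma laplacian_radius_caterpillar_le:
  assumes rs: "rs \<noteq> []" and m: "m > 1"
    and pos: "\<And>i. i < length rs \<Longrightarrow> 0 < z i"
    and super: "\<And>i. i < length rs \<Longrightarrow>
      (real (rs ! i) * (m / (m - 1)) - m) * z i + (if i = 0 then 0 else z i + z (i - 1))
        + (if Suc i < length rs then z i + z (Suc i) else 0) \<le> 0"
  shows "laplacian_radius (caterpillar rs) \<le> m"
proof -
  interpret pair_graph "caterpillar rs"
    by (rule pair_graph_caterpillar)
  define y where "y u = (if snd u = 0 then z (fst u) else z (fst u) / (m - 1))" for u :: "nat \<times> nat"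
  show ?thesis
  proof (rule laplacian_radius_le_supersolution[where z = y])
    show "pverts (caterpillar rs) \<noteq> {}"
      using rs by (rule pverts_caterpillar_nonempty)
    show "0 < y v" if "v \<in> pverts (caterpillar rs)" for v
      using that pos m by (auto simp: y_def pverts_caterpillar)
    fix v assume v: "v \<in> pverts (caterpillar rs)"
    obtain i j where ij: "v = (i, j)"
      by (cases v)
    with v have i: "i < length rs" "j \<le> rs ! i"
      by (auto simp: pverts_caterpillar)
    show "(\<Sum>u\<in>parcs (caterpillar rs) `` {v}. y v + y u) \<le> m * y v"
    proof (cases "j = 0")
      case False
      then have "parcs (caterpillar rs) `` {v} = {(i, 0)}"
        using i by (auto simp: ij parcs_caterpillar_iff)
      then show ?thesis
        using False m by (simp add: ij y_def field_simps)
    next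
      case True
      define P where "P = (if i = 0 then {} else {(i - 1, 0::nat)})"
      define N where "N = (if Suc i < length rs then {(Suc i, 0::nat)} else {})"
      define L where "L = Pair i ` {1..rs ! i}"
      have nbhd: "parcs (caterpillar rs) `` {v} = P \<union> N \<union> L"
        using i by (auto simp: ij True parcs_caterpillar_iff P_def N_def L_def)
      have "(\<Sum>u\<in>P \<union> N \<union> L. y v + y u)
          = (\<Sum>u\<in>P. y v + y u) + (\<Sum>u\<in>N. y v + y u) + (\<Sum>u\<in>L. y v + y u)"
        by (subst sum.union_disjoint, auto simp: P_def N_def L_def)+
      moreover have "(\<Sum>u\<in>P. y v + y u) = (if i = 0 then 0 else z i + z (i - 1))"
        by (simp add: P_def ij True y_def)
      moreover have "(\<Sum>u\<in>N. y v + y u) = (if Suc i < length rs then z i + z (Suc i) else 0)"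
        by (simp add: N_def ij True y_def)
      moreover have "(\<Sum>u\<in>L. y v + y u) = real (rs ! i) * (z i + z i / (m - 1))"
        by (simp add: L_def sum.reindex inj_on_def ij True y_def)
      moreover have "z i + z i / (m - 1) = (m / (m - 1)) * z i"
        using m by (simp add: field_simps)
      ultimately show ?thesis
        using super[OF i(1)] unfolding nbhd by (simp add: ij True y_def algebra_simps)
    qed
  qed
qed

section \<open>The Shearer sequence\<close>

text \<open>Since \<open>x + 1 / x > 2\<close> for positive \<open>x \<noteq> 1\<close>, it suffices
  that \<open>shearer_omega > 1\<close>; the smaller cube root exceeds 1 because
  \<open>3 * sqrt 33 < 18\<close>.\<close>

lemma mu_min_gt_4: "4 < mu_min"
proof -
  have "5 < sqrt 33" "sqrt 33 < 6"
    by (rule real_less_rsqrt, simp) (rule real_less_lsqrt, simp_all)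
  then have "1 < root 3 (19 + 3 * sqrt 33)" "1 < root 3 (19 - 3 * sqrt 33)"
    by simp_all
  then have "1 < shearer_omega"
    unfolding shearer_omega_def by argo
  then have "0 < (shearer_omega - 1)\<^sup>2 / shearer_omega"
    by simp
  also have "\<dots> = shearer_omega + inverse shearer_omega - 2"
    using \<open>1 < shearer_omega\<close> by (simp add: field_simps power2_eq_square)
  finally show ?thesis
    by (simp add: mu_min_def)
qed

context
  fixes \<mu> :: real
  assumes mu: "4 < \<mu>"
begin

text \<open>This is the fixed-point equation of \<open>shearer_psi\<close> with its denominator
  cleared; \<open>4 < \<mu>\<close> makes the discriminant nonnegative.\<close>

lemma shearer_theta_quadratic: "(shearer_theta \<mu>)\<^sup>2 + (\<mu> - 2) * shearer_theta \<mu> + 1 = 0"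
proof -
  define d where "d = sqrt ((\<mu> - 2)\<^sup>2 - 4)"
  have "2\<^sup>2 \<le> (\<mu> - 2)\<^sup>2"
    using mu by (intro power_mono) auto
  then have "0 \<le> (\<mu> - 2)\<^sup>2 - 4"
    by simp
  then have d: "d\<^sup>2 = (\<mu> - 2)\<^sup>2 - 4"
    unfolding d_def by (rule real_sqrt_pow2)
  have theta: "shearer_theta \<mu> = (d - (\<mu> - 2)) / 2"
    by (simp add: shearer_theta_def d_def)
  show ?thesis
    unfolding theta using d by (simp add: field_simps power2_eq_square)
qed

lemma shearer_theta_neg: "shearer_theta \<mu> < 0"
proof -
  have "sqrt ((\<mu> - 2)\<^sup>2 - 4) < \<mu> - 2"
    using mu by (intro real_less_lsqrt) auto
  then show ?thesis
    by (simp add: shearer_theta_def)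
qed

lemma shearer_psi_theta: "shearer_psi \<mu> (shearer_theta \<mu>) = shearer_theta \<mu>"
  using shearer_theta_quadratic shearer_theta_neg
  by (simp add: shearer_psi_def field_simps power2_eq_square)

text \<open>Ensures that the floor defining the first entry is not truncated by
  \<open>nat\<close>.\<close>

lemma shearer_theta_ge: "1 - \<mu> \<le> shearer_theta \<mu>"
proof -
  have "2\<^sup>2 \<le> (\<mu> - 2)\<^sup>2"
    using mu by (intro power_mono) auto
  then have "0 \<le> sqrt ((\<mu> - 2)\<^sup>2 - 4)"
    by simp
  then show ?thesis
    using mu by (simp add: shearer_theta_def field_simps)
qed

text \<open>Rounding down can only lose; the hypothesis excludes negative arguments, which
  \<open>nat\<close> would raise to 0.\<close>

lemma nat_floor_mult_le:
  assumes "0 \<le> x"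
  shows "real (nat \<lfloor>(\<mu> - 1) / \<mu> * x\<rfloor>) * (\<mu> / (\<mu> - 1)) \<le> x"
proof -
  have "0 \<le> (\<mu> - 1) / \<mu> * x"
    using assms mu by simp
  then have "real (nat \<lfloor>(\<mu> - 1) / \<mu> * x\<rfloor>) \<le> (\<mu> - 1) / \<mu> * x"
    by (rule of_nat_floor)
  then show ?thesis
    using mu by (simp add: field_simps)
qed

text \<open>\<open>shearer_psi \<mu>\<close> increases on the negative reals and fixes
  \<open>shearer_theta \<mu>\<close>.\<close>

lemma shearer_psi_le_theta:
  assumes "t \<le> shearer_theta \<mu>"
  shows "shearer_psi \<mu> t \<le> shearer_theta \<mu>"
proof -
  have "1 / shearer_theta \<mu> \<le> 1 / t"
    using assms shearer_theta_neg by (simp add: divide_simps)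
  then have "shearer_psi \<mu> t \<le> shearer_psi \<mu> (shearer_theta \<mu>)"
    by (simp add: shearer_psi_def)
  then show ?thesis
    by (simp add: shearer_psi_theta)
qed

text \<open>Each entry is the number of leaves that fit below \<open>shearer_theta \<mu>\<close>;
  the room for them is nonnegative because \<open>shearer_psi\<close> preserves the bound.\<close>

lemma shearer_S_le_theta: "shearer_S \<mu> j \<le> shearer_theta \<mu>"
proof (induction j)
  case 0
  show ?case
    using nat_floor_mult_le[of "shearer_theta \<mu> - (1 - \<mu>)"] shearer_theta_ge by simp
next
  case (Suc j)
  then show ?case
    using nat_floor_mult_le[of "shearer_theta \<mu> - shearer_psi \<mu> (shearer_S \<mu> j)"]
      shearer_psi_le_theta by simp
qed

lemma shearer_S_neg: "shearer_S \<mu> j < 0"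
  using shearer_S_le_theta shearer_theta_neg by (rule order_le_less_trans)

text \<open>The additional 1 in the last entry is scaled by \<open>(\<mu> - 1) / \<mu> < 1\<close>,
  so the floor rises by at most one. This is the condition under which consecutive caterpillars
  embed.\<close>

lemma shearer_last_le: "shearer_last \<mu> (Suc (Suc n)) \<le> Suc (shearer_r \<mu> (Suc n))"
proof -
  define x where "x = shearer_theta \<mu> - shearer_psi \<mu> (shearer_S \<mu> n)"
  have "(\<mu> - 1) / \<mu> * (x + 1) \<le> (\<mu> - 1) / \<mu> * x + 1"
    using mu by (simp add: field_simps)
  then have "\<lfloor>(\<mu> - 1) / \<mu> * (x + 1)\<rfloor> \<le> \<lfloor>(\<mu> - 1) / \<mu> * x\<rfloor> + 1"
    by linarith
  then show ?thesis
    by (simp add: shearer_last_def x_def algebra_simps)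
qed

text \<open>Rounding down bounds the left side by \<open>shearer_theta \<mu> + 1\<close>, which is
  below 1. This is the supersolution inequality at the last spine vertex, divided by its
  weight.\<close>

lemma shearer_last_mult_le:
  "real (shearer_last \<mu> (Suc (Suc n))) * (\<mu> / (\<mu> - 1)) + shearer_psi \<mu> (shearer_S \<mu> n) \<le> 1"
  using nat_floor_mult_le[of "shearer_theta \<mu> + 1 - shearer_psi \<mu> (shearer_S \<mu> n)"]
    shearer_psi_le_theta[OF shearer_S_le_theta, of n] shearer_theta_neg
  by (simp add: shearer_last_def)

text \<open>
  With \<open>z (Suc i) = - S i * z i\<close> on the spine, every inequality of the supersolution except the one at
  the last spine vertex is an equality.
\<close>

lemma laplacian_radius_shearer_graph_le: "laplacian_radius (shearer_graph \<mu> (Suc (Suc n))) \<le> \<mu>"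
proof -
  define rs where "rs = map (shearer_r \<mu>) [0..<Suc n] @ [shearer_last \<mu> (Suc (Suc n))]"
  define z where "z i = (\<Prod>j<i. - shearer_S \<mu> j)" for i
  have z_Suc: "z (Suc i) = - shearer_S \<mu> i * z i" for i
    by (simp add: z_def)
  have z_pos: "0 < z i" for i
    unfolding z_def by (intro prod_pos) (simp add: shearer_S_neg)
  \<comment> \<open>Dividing \<open>z (Suc i)\<close> by \<open>shearer_S \<mu> i\<close> gives back
    \<open>- z i\<close>, so \<open>shearer_psi\<close> encodes the three-term recurrence along the
    spine.\<close>
  have S_psi: "shearer_psi \<mu> (shearer_S \<mu> i) * z (Suc i) = (2 - \<mu>) * z (Suc i) + z i" for i
    using shearer_S_neg[of i] by (simp add: shearer_psi_def z_Suc field_simps)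
  have "laplacian_radius (caterpillar rs) \<le> \<mu>"
  proof (rule laplacian_radius_caterpillar_le[where z = z])
    fix i assume "i < length rs"
    then have i: "i \<le> Suc n"
      by (simp add: rs_def)
    let ?l = "real (rs ! i) * (\<mu> / (\<mu> - 1))"
    show "(?l - \<mu>) * z i + (if i = 0 then 0 else z i + z (i - 1))
        + (if Suc i < length rs then z i + z (Suc i) else 0) \<le> 0"
    proof (cases i)
      case 0
      then have l: "?l = shearer_S \<mu> i - 1 + \<mu>"
        by (simp add: rs_def nth_append del: shearer_r.simps upt_Suc)
      have "(?l - \<mu>) * z i + (z i + z (Suc i)) = 0"
        unfolding z_Suc l by (simp add: algebra_simps)
      then show ?thesis
        using 0 by (simp add: rs_def)
    next
      case (Suc i')
      have eq: "(?l - \<mu>) * z i + z i + z i' = (?l + shearer_psi \<mu> (shearer_S \<mu> i') - 1) * z i"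
        using S_psi[of i'] Suc by (simp add: algebra_simps)
      show ?thesis
      proof (cases "i = Suc n")
        case True
        with Suc have "?l + shearer_psi \<mu> (shearer_S \<mu> i') - 1 \<le> 0"
          using shearer_last_mult_le[of n] by (simp add: rs_def nth_append)
        with z_pos[of i] have "(?l - \<mu>) * z i + z i + z i' \<le> 0"
          unfolding eq by (simp add: mult_nonpos_nonneg)
        then show ?thesis
          using True Suc by (simp add: rs_def)
      next
        case False
        with i have "?l = real (shearer_r \<mu> i) * (\<mu> / (\<mu> - 1))"
          by (simp add: rs_def nth_append del: shearer_r.simps upt_Suc)
        then have l: "?l + shearer_psi \<mu> (shearer_S \<mu> i') - 1 = shearer_S \<mu> i - 1"
          using Suc by simp
        \<comment> \<open>The right neighbour contributes \<open>z i + z (Suc i)\<close>, which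
          cancels this exactly.\<close>
        have "(?l - \<mu>) * z i + z i + z i' = - z i - z (Suc i)"
          unfolding eq l z_Suc by (simp add: algebra_simps)
        then show ?thesis
          using False i Suc by (simp add: rs_def)
      qed
    qed
  qed (use mu z_pos in \<open>auto simp: rs_def\<close>)
  then show ?thesis
    by (simp add: shearer_graph_def rs_def)
qed

lemma incseq_laplacian_radius_shearer_graph:
  "incseq (\<lambda>n. laplacian_radius (shearer_graph \<mu> (Suc (Suc n))))"
proof (rule incseq_SucI)
  fix n
  show "laplacian_radius (shearer_graph \<mu> (Suc (Suc n)))
      \<le> laplacian_radius (shearer_graph \<mu> (Suc (Suc (Suc n))))"
    using laplacian_radius_caterpillar_append_mono[OF shearer_last_le[of n],
        of "map (shearer_r \<mu>) [0..<Suc n]" "shearer_last \<mu> (Suc (Suc (Suc n)))"]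
    by (simp add: shearer_graph_def)
qed

lemma laplacian_radius_shearer_graph_strict:
  "laplacian_radius (shearer_graph \<mu> (Suc (Suc n)))
     < laplacian_radius (shearer_graph \<mu> (Suc (Suc (Suc (Suc n)))))"
  using laplacian_radius_caterpillar_append2_strict_mono[OF shearer_last_le[of n]
      shearer_last_le[of "Suc n"], of "map (shearer_r \<mu>) [0..<Suc n]"
      "shearer_last \<mu> (Suc (Suc (Suc (Suc n))))"]
  by (simp add: shearer_graph_def)

end

theorem theorem3p3:
  fixes \<mu> :: real
  assumes "\<mu> \<ge> mu_min"
  shows "\<exists>\<gamma>. (\<lambda>k. laplacian_radius (shearer_graph \<mu> k)) \<longlonglongrightarrow> \<gamma> \<and>
    laplacian_limit_point \<gamma> \<and> \<gamma> \<le> \<mu>"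
proof -
  have mu: "4 < \<mu>"
    using mu_min_gt_4 assms by simp
  \<comment> \<open>The shift by two starts the sequence where \<open>shearer_graph\<close> becomes
    meaningful.\<close>
  let ?\<rho> = "\<lambda>n. laplacian_radius (shearer_graph \<mu> (Suc (Suc n)))"
  obtain \<gamma> where lim: "?\<rho> \<longlonglongrightarrow> \<gamma>"
    using incseq_laplacian_radius_shearer_graph[OF mu] laplacian_radius_shearer_graph_le[OF mu]
    by (metis incseq_convergent)
  \<comment> \<open>Neighbouring radii may coincide, so the pairwise distinct values come from every
    second graph; the limit is the same.\<close>
  have "strict_mono (\<lambda>i. ?\<rho> (2 * i))"
    using laplacian_radius_shearer_graph_strict[OF mu] by (simp add: strict_mono_Suc_iff)
  moreover have "(\<lambda>i. ?\<rho> (2 * i)) \<longlonglongrightarrow> \<gamma>"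
    using LIMSEQ_subseq_LIMSEQ[OF lim, of "\<lambda>i. 2 * i"] by (simp add: strict_mono_def o_def)
  ultimately have "laplacian_limit_point \<gamma>"
    by (intro laplacian_limit_pointI[of "\<lambda>i. shearer_graph \<mu> (Suc (Suc (2 * i)))"])
      (simp_all add: shearer_graph_def pair_graph_caterpillar pverts_caterpillar_nonempty
        strict_mono_imp_inj_on)
  moreover have "\<gamma> \<le> \<mu>"
    using lim laplacian_radius_shearer_graph_le[OF mu] by (intro LIMSEQ_le_const2) auto
  moreover have "(\<lambda>k. laplacian_radius (shearer_graph \<mu> k)) \<longlonglongrightarrow> \<gamma>"
    by (rule LIMSEQ_offset[where k = 2]) (use lim in simp)
  ultimately show ?thesis
    by blast
qed

end
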